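(* For all integers $n,k\ge0$ we have \[ \mathrm{rac}_+^k(n)=\sum_{2r+j=n-2k}\binom{r+k}{r}\binom{r+j-1}{j}, \] and this number is also equal to the number of compositions of $n-k$ with exactly $k$ parts equal to $1$.
   Context: A composition of $n$ is a finite sequence $\alpha=(\alpha_1,\ldots,\alpha_\ell)$ of positive integers with $\alpha_1+\cdots+\alpha_\ell=n$; the empty sequence ($\ell=0$) is the only composition of $0$, and there are no compositions of a negative integer. Two compositions of the same length $\ell$ are called equivalent if one is obtained from the other by a sequence of swaps, each swap exchanging the $i$th part and the $(\ell+1-i)$th part for some $1\le i\le\ell/2$. The number $\mathrm{rac}_+^k(n)$ is the number of equivalence classes of compositions $\alpha=(\alpha_1,\ldots,\alpha_\ell)$ of $n$ such that $\#\{1\le i\le \ell/2:\alpha_i=\alpha_{\ell+1-i}\}=k$ and either $\ell$ is even, or $\ell$ is odd and the middle part $\alpha_{(\ell+1)/2}$ is even. Convention for binomial coefficients, for integers $a,b$: $\binom{a}{b}=\frac{a!}{b!(a-b)!}$ if $a\ge b\ge1$; $\binom{a}{b}=1$ if $b=0$ (for every integer $a$, including $a=-1$); $\binom{a}{b}=0$ otherwise. Summation indices range over nonnegative integers. *)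

theory Defs
  imports Main
begin

text \<open>
  Parts are indexed from 0, as usual for lists: the \<open>i\<close>th part in 1-based counting is
  \<open>\<alpha> ! (i - 1)\<close>, so the parts with list indices \<open>i\<close> and \<open>length \<alpha> - 1 - i\<close> mirror each other.
\<close>

definition compositions :: "int \<Rightarrow> nat list set" where
  "compositions n = {\<alpha>. (\<forall>x \<in> set \<alpha>. 1 \<le> x) \<and> int (sum_list \<alpha>) = n}"

definition mirror_swap :: "nat \<Rightarrow> nat list \<Rightarrow> nat list" where
  "mirror_swap i \<alpha> =
     \<alpha>[i := \<alpha> ! (length \<alpha> - 1 - i), length \<alpha> - 1 - i := \<alpha> ! i]"

definition swap_step :: "nat list rel" where
  "swap_step = {(\<alpha>, \<beta>). \<exists>i < length \<alpha> div 2. \<beta> = mirror_swap i \<alpha>}"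

definition swap_equiv :: "nat list rel" where
  "swap_equiv = swap_step\<^sup>*"

lemma equiv_swap_equiv: "equiv UNIV swap_equiv"
proof -
  have "sym swap_step"
  proof (rule symI)
    fix \<alpha> \<beta> assume "(\<alpha>, \<beta>) \<in> swap_step"
    then obtain i where i: "i < length \<alpha> div 2" and \<beta>: "\<beta> = mirror_swap i \<alpha>"
      by (auto simp: swap_step_def)
    have "\<alpha> = mirror_swap i \<beta>"
      using i by (intro nth_equalityI) (auto simp: \<beta> mirror_swap_def nth_list_update)
    moreover have "length \<beta> = length \<alpha>"
      by (simp add: \<beta> mirror_swap_def)
    ultimately show "(\<beta>, \<alpha>) \<in> swap_step"
      using i by (auto simp: swap_step_def)
  qed
  then show ?thesis
    by (auto simp: swap_equiv_def intro!: equivI refl_rtrancl sym_rtrancl trans_rtrancl)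
qed

definition palindromic_pairs :: "nat list \<Rightarrow> nat" where
  "palindromic_pairs \<alpha> =
     card {i. i < length \<alpha> div 2 \<and> \<alpha> ! i = \<alpha> ! (length \<alpha> - 1 - i)}"

text \<open>For odd length, the middle part has list index \<open>length \<alpha> div 2\<close>.\<close>

definition rac_plus :: "nat \<Rightarrow> nat \<Rightarrow> nat" where
  "rac_plus k n =
     card ({\<alpha> \<in> compositions (int n). palindromic_pairs \<alpha> = k \<and>
              (even (length \<alpha>) \<or>
               odd (length \<alpha>) \<and> even (\<alpha> ! (length \<alpha> div 2)))} // swap_equiv)"

text \<open>
  The convention is 1 for \<open>b = 0\<close> and every \<open>a\<close>, including \<open>a = -1\<close>, and 0 whenever
  \<open>b < 0\<close> or \<open>a < b \<noteq> 0\<close>; it differs from \<open>gchoose\<close> at negative \<open>a\<close>.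
\<close>

definition int_binom :: "int \<Rightarrow> int \<Rightarrow> nat" where
  "int_binom a b =
     (if b = 0 then 1 else if 1 \<le> b \<and> b \<le> a then nat a choose nat b else 0)"

end

theory Submission
  imports Defs "HOL-Computational_Algebra.Formal_Power_Series"
begin

text \<open>
  Both countings are countings of words in which exactly \<open>k\<close> letters are marked. If the unmarked
  letters have generating function \<open>U\<close> and the marked ones \<open>M\<close>, such words have generating function
  \<open>M\<^sup>k / (1 - U)\<^sup>k\<^sup>+\<^sup>1\<close>: the \<open>k\<close> marked letters separate \<open>k + 1\<close> free words in the
  unmarked letters (\<open>weight_gf_marked_words\<close>).

  A composition with \<open>k\<close> ones is a word whose marked letter is 1 and whose unmarked letters are
  the parts \<open>\<ge> 2\<close>, so \<open>M = X\<close> and \<open>U = Q := X\<^sup>2 / (1 - X)\<close>.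

  A swap class forgets only the order inside each pair of mirrored parts
  (\<open>swap_equiv_iff\<close>). It is therefore a word in unordered pairs \<open>a \<le> b\<close> of positive integers, marked
  when \<open>a = b\<close>, together with a middle part; with an even middle part, or none, the latter ranges
  over the even naturals when 0 stands for its absence (\<open>rac_plus_eq_card_codes\<close>). Here
  \<open>M = X\<^sup>2 / (1 - X\<^sup>2)\<close>, \<open>U = X\<^sup>3 / ((1 - X) (1 - X\<^sup>2))\<close>, and the middle part contributes
  \<open>1 / (1 - X\<^sup>2)\<close>. The identity on which everything rests is
  \[ (1 - U) (1 - X) (1 - X^2) = 1 - X - X^2 = (1 - Q) (1 - X) . \]
  It gives \<open>1 - U = (1 - Q) / (1 - X\<^sup>2)\<close>; the \<open>k + 1\<close> factors \<open>1 - X\<^sup>2\<close> that this contributes are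
  exactly cancelled by the \<open>k\<close> denominators of \<open>M\<^sup>k\<close> and the one of the middle part. What remains is
  \<open>X\<^sup>2\<^sup>k / (1 - Q)\<^sup>k\<^sup>+\<^sup>1\<close> (\<open>weight_gf_class_codes\<close>), which is \<open>X\<^sup>k\<close> times the series
  of the compositions with \<open>k\<close> ones (\<open>weight_gf_compositions_ones\<close>). Expanding
  \<open>1 / (1 - Q)\<^sup>k\<^sup>+\<^sup>1\<close> in powers of \<open>Q\<close> gives the double binomial sum
  (\<open>diag_binomial_compose_nth\<close>).

  Over the integers quotients of power series are avoided: each closed form is stated as a product
  equation, and denominators are cancelled in the integral domain of power series.
\<close>

unbundle fps_syntax

section \<open>Generating functions of weighted sets\<close>

definition weight_gf :: "('a \<Rightarrow> nat) \<Rightarrow> 'a set \<Rightarrow> int fps" where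
  "weight_gf w A = Abs_fps (\<lambda>n. int (card {x \<in> A. w x = n}))"

text \<open>
  The cardinality of an infinite set is 0, so the sum and product rules for \<open>weight_gf\<close> need
  finitely many elements of each weight.
\<close>

definition finite_fibres :: "('a \<Rightarrow> nat) \<Rightarrow> 'a set \<Rightarrow> bool" where
  "finite_fibres w A \<longleftrightarrow> (\<forall>n. finite {x \<in> A. w x = n})"

lemma weight_gf_nth: "weight_gf w A $ n = int (card {x \<in> A. w x = n})"
  by (simp add: weight_gf_def)

lemma finite_fibres_subset: "finite_fibres w B \<Longrightarrow> A \<subseteq> B \<Longrightarrow> finite_fibres w A"
  unfolding finite_fibres_def by (auto intro: finite_subset[of "{x \<in> A. w x = n}" "{x \<in> B. w x = n}" for n])

lemma finite_fibres_le:
  assumes "finite_fibres w A"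
  shows "finite {x \<in> A. w x \<le> n}"
proof -
  have "{x \<in> A. w x \<le> n} = (\<Union>i\<le>n. {x \<in> A. w x = i})"
    by auto
  then show ?thesis
    using assms by (simp add: finite_fibres_def)
qed

lemma weight_gf_cong_bij:
  assumes "bij_betw f A B" "\<And>x. x \<in> A \<Longrightarrow> v (f x) = w x"
  shows "weight_gf v B = weight_gf w A"
proof (rule fps_ext)
  fix n
  have "bij_betw f {x \<in> A. w x = n} {y \<in> B. v y = n}"
    using assms by (fastforce simp: bij_betw_def inj_on_def)
  then show "weight_gf v B $ n = weight_gf w A $ n"
    by (simp add: weight_gf_nth bij_betw_same_card)
qed

lemma weight_gf_Un:
  assumes "finite_fibres w (A \<union> B)" "A \<inter> B = {}"
  shows "weight_gf w (A \<union> B) = weight_gf w A + weight_gf w B"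
proof (rule fps_ext)
  fix n
  have "{x \<in> A \<union> B. w x = n} = {x \<in> A. w x = n} \<union> {x \<in> B. w x = n}"
    by auto
  moreover have "finite {x \<in> A. w x = n}" "finite {x \<in> B. w x = n}"
    using assms(1) finite_fibres_subset[of w "A \<union> B"] by (auto simp: finite_fibres_def)
  moreover have "{x \<in> A. w x = n} \<inter> {x \<in> B. w x = n} = {}"
    using assms(2) by auto
  ultimately show "weight_gf w (A \<union> B) $ n = (weight_gf w A + weight_gf w B) $ n"
    by (simp add: weight_gf_nth card_Un_disjoint)
qed

lemma weight_gf_Times:
  assumes "finite_fibres w A" "finite_fibres v B"
  shows "weight_gf (\<lambda>(x, y). w x + v y) (A \<times> B) = weight_gf w A * weight_gf v B"
proof (rule fps_ext)
  fix n
  let ?F = "\<lambda>i. {x \<in> A. w x = i} \<times> {y \<in> B. v y = n - i}"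
  have "{p \<in> A \<times> B. (case p of (x, y) \<Rightarrow> w x + v y) = n} = (\<Union>i\<in>{0..n}. ?F i)"
    by auto
  moreover have "card (\<Union>i\<in>{0..n}. ?F i) = (\<Sum>i\<in>{0..n}. card (?F i))"
    using assms by (intro card_UN_disjoint) (auto simp: finite_fibres_def)
  ultimately show "weight_gf (\<lambda>(x, y). w x + v y) (A \<times> B) $ n = (weight_gf w A * weight_gf v B) $ n"
    by (simp add: weight_gf_nth fps_mult_nth card_cartesian_product)
qed

lemma weight_gf_shift: "weight_gf (\<lambda>x. c + w x) A = fps_X ^ c * weight_gf w A"
proof (rule fps_ext)
  fix n
  have "{x \<in> A. c + w x = n} = (if n < c then {} else {x \<in> A. w x = n - c})"
    by auto
  then show "weight_gf (\<lambda>x. c + w x) A $ n = (fps_X ^ c * weight_gf w A) $ n"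
    by (simp add: weight_gf_nth fps_X_power_mult_nth)
qed

lemma weight_gf_singleton: "weight_gf w {x} = fps_X ^ w x"
proof (rule fps_ext)
  fix n
  have "{y \<in> {x}. w y = n} = (if n = w x then {x} else {})"
    by auto
  then show "weight_gf w {x} $ n = (fps_X ^ w x) $ n"
    by (simp add: weight_gf_nth fps_X_power_nth)
qed

lemma finite_fibres_inj:
  assumes "inj_on w A"
  shows "finite_fibres w A"
  unfolding finite_fibres_def
proof
  fix n
  have "finite (w ` {x \<in> A. w x = n})"
    by (rule finite_subset[of _ "{n}"]) auto
  moreover have "inj_on w {x \<in> A. w x = n}"
    using assms by (rule inj_on_subset) auto
  ultimately show "finite {x \<in> A. w x = n}"
    by (rule finite_imageD)
qed

text \<open>
  The geometric series \<open>1 / (1 - X\<^sup>d)\<close>, from splitting the naturals into 0 and successors.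
\<close>

lemma weight_gf_multiples:
  assumes "d > 0"
  shows "weight_gf (\<lambda>i. d * i) UNIV * (1 - fps_X ^ d) = 1"
proof -
  have "UNIV = {0} \<union> range Suc"
    by (auto simp: image_iff) (metis not0_implies_Suc)
  moreover have "finite_fibres (\<lambda>i. d * i) ({0} \<union> range Suc)"
    using assms by (intro finite_fibres_inj) (auto simp: inj_on_def)
  ultimately have "weight_gf (\<lambda>i. d * i) UNIV
      = weight_gf (\<lambda>i. d * i) {0} + weight_gf (\<lambda>i. d * i) (range Suc)"
    by (metis weight_gf_Un image_iff nat.distinct(1) disjoint_insert(1) inf_bot_left insert_disjoint(1))
  also have "weight_gf (\<lambda>i. d * i) (range Suc) = weight_gf (\<lambda>i. d + d * i) UNIV"
    by (rule weight_gf_cong_bij[of Suc]) (auto simp: bij_betw_def)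
  finally show ?thesis
    by (simp add: weight_gf_singleton weight_gf_shift algebra_simps)
qed

section \<open>Words with a prescribed number of marked letters\<close>

definition marked_words :: "'a set \<Rightarrow> ('a \<Rightarrow> bool) \<Rightarrow> nat \<Rightarrow> 'a list set" where
  "marked_words S m k = {xs \<in> lists S. length (filter m xs) = k}"

abbreviation word_weight :: "('a \<Rightarrow> nat) \<Rightarrow> 'a list \<Rightarrow> nat" where
  "word_weight w xs \<equiv> sum_list (map w xs)"

text \<open>
  Letters of positive weight bound both the length of a word and the weight of each of its letters
  by the weight of the word.
\<close>

lemma finite_fibres_lists:
  assumes fin: "finite_fibres w S" and pos: "\<And>x. x \<in> S \<Longrightarrow> 1 \<le> w x"
  shows "finite_fibres (word_weight w) (lists S)"
  unfolding finite_fibres_def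
proof
  fix n
  have bound: "length xs \<le> word_weight w xs" if "xs \<in> lists S" for xs
    using that by (induction xs) (use pos in force)+
  have letter: "w x \<le> word_weight w xs" if "x \<in> set xs" for x xs
    using that by (simp add: member_le_sum_list)
  have "{xs \<in> lists S. word_weight w xs = n}
          \<subseteq> {xs. set xs \<subseteq> {x \<in> S. w x \<le> n} \<and> length xs \<le> n}"
    using bound letter by fastforce
  then show "finite {xs \<in> lists S. word_weight w xs = n}"
    by (rule finite_subset) (intro finite_lists_length_le finite_fibres_le[OF fin])
qed

text \<open>
  Removing the first letter of a nonempty word gives \<open>W 0 = 1 + U * W 0\<close> and
  \<open>W (k + 1) = U * W (k + 1) + M * W k\<close> for the generating functions \<open>W\<close> of the words.
\<close>

theorem weight_gf_marked_words:
  fixes w :: "'a \<Rightarrow> nat" and m :: "'a \<Rightarrow> bool"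
  assumes fin: "finite_fibres w S" and pos: "\<And>x. x \<in> S \<Longrightarrow> 1 \<le> w x"
  defines "U \<equiv> weight_gf w {x \<in> S. \<not> m x}" and "M \<equiv> weight_gf w {x \<in> S. m x}"
  shows "weight_gf (word_weight w) (marked_words S m k) * (1 - U) ^ Suc k = M ^ k"
proof -
  let ?W = "\<lambda>k. weight_gf (word_weight w) (marked_words S m k)"
  let ?C = "\<lambda>A k. (\<lambda>(x, xs). x # xs) ` (A \<times> marked_words S m k)"
  have finW: "finite_fibres (word_weight w) B" if "B \<subseteq> lists S" for B
    using finite_fibres_subset[OF finite_fibres_lists[OF fin pos] that] .
  have sub: "marked_words S m k \<subseteq> lists S" for k
    by (auto simp: marked_words_def)
  have cons: "weight_gf (word_weight w) (?C A k) = weight_gf w A * ?W k" if "A \<subseteq> S" for A k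
  proof -
    have "weight_gf (word_weight w) (?C A k)
        = weight_gf (\<lambda>(x, xs). w x + word_weight w xs) (A \<times> marked_words S m k)"
      by (rule weight_gf_cong_bij[of "\<lambda>(x, xs). x # xs"]) (auto simp: bij_betw_def inj_on_def)
    also have "\<dots> = weight_gf w A * ?W k"
      using that finite_fibres_subset[OF fin] finW[OF sub] by (intro weight_gf_Times) auto
    finally show ?thesis .
  qed
  have zero: "marked_words S m 0 = {[]} \<union> ?C {x \<in> S. \<not> m x} 0" (is "_ = ?L")
  proof (rule set_eqI)
    fix xs show "xs \<in> marked_words S m 0 \<longleftrightarrow> xs \<in> ?L"
      by (cases xs) (auto simp: marked_words_def image_iff)
  qed
  have suc: "marked_words S m (Suc k) = ?C {x \<in> S. \<not> m x} (Suc k) \<union> ?C {x \<in> S. m x} k" (is "_ = ?L") for k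
  proof (rule set_eqI)
    fix xs show "xs \<in> marked_words S m (Suc k) \<longleftrightarrow> xs \<in> ?L"
      by (cases xs) (auto simp: marked_words_def image_iff)
  qed
  show ?thesis
  proof (induction k)
    case 0
    have "?W 0 = weight_gf (word_weight w) {[]} + weight_gf (word_weight w) (?C {x \<in> S. \<not> m x} 0)"
      by (subst zero, rule weight_gf_Un) (auto intro!: finW simp: marked_words_def)
    also have "\<dots> = 1 + U * ?W 0"
      by (subst cons) (auto simp: U_def weight_gf_singleton)
    finally show ?case
      by (simp add: algebra_simps)
  next
    case (Suc k)
    have "?W (Suc k) = weight_gf (word_weight w) (?C {x \<in> S. \<not> m x} (Suc k))
        + weight_gf (word_weight w) (?C {x \<in> S. m x} k)"
      by (subst suc, rule weight_gf_Un) (auto intro!: finW simp: marked_words_def)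
    also have "\<dots> = U * ?W (Suc k) + M * ?W k"
      by (subst cons, force, subst cons) (auto simp: U_def M_def)
    finally have step: "?W (Suc k) * (1 - U) = M * ?W k"
      by (simp add: algebra_simps)
    have "?W (Suc k) * (1 - U) ^ Suc (Suc k) = (?W (Suc k) * (1 - U)) * (1 - U) ^ Suc k"
      by (simp only: power_Suc ac_simps)
    also have "\<dots> = M * (?W k * (1 - U) ^ Suc k)"
      by (simp only: step mult.assoc)
    finally show ?case
      by (simp only: Suc.IH power_Suc[of M])
  qed
qed

section \<open>Compositions with a prescribed number of ones\<close>

lemma compositions_int: "compositions (int n) = {\<alpha> \<in> lists {1..}. sum_list \<alpha> = n}"
  by (auto simp: compositions_def)

lemma compositions_negative: "n < 0 \<Longrightarrow> compositions n = {}"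
  by (auto simp: compositions_def)

text \<open>
  The series \<open>1 / (1 - X)\<^sup>k\<^sup>+\<^sup>1\<close>, given by its coefficients, which lie on a diagonal of the
  Pascal triangle.
\<close>

definition diag_binomial_fps :: "nat \<Rightarrow> int fps" where
  "diag_binomial_fps k = Abs_fps (\<lambda>r. int (r + k choose r))"

text \<open>
  Multiplication by \<open>1 - X\<close> takes differences of consecutive coefficients, and by the Pascal rule
  these are the coefficients for \<open>k - 1\<close>.
\<close>

lemma diag_binomial_fps_mult: "diag_binomial_fps k * (1 - fps_X) ^ Suc k = 1"
proof (induction k)
  case 0
  have "diag_binomial_fps 0 $ n - (fps_X * diag_binomial_fps 0) $ n = (1 :: int fps) $ n" for n
    by (cases n) (simp_all add: diag_binomial_fps_def)
  then show ?case
    by (simp add: fps_eq_iff algebra_simps)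
next
  case (Suc k)
  have "(diag_binomial_fps (Suc k) * (1 - fps_X)) $ n = diag_binomial_fps k $ n" for n
    by (cases n) (simp_all add: diag_binomial_fps_def algebra_simps)
  then have "diag_binomial_fps (Suc k) * (1 - fps_X) = diag_binomial_fps k"
    by (rule fps_ext)
  then show ?case
    using Suc.IH by (metis mult.assoc power_Suc)
qed

text \<open>
  The series \<open>Q = X\<^sup>2 / (1 - X)\<close> of a single part other than 1.
\<close>

definition big_part_fps :: "int fps" where
  "big_part_fps = weight_gf (\<lambda>x. x) {2..}"

lemma big_part_fps_eq: "big_part_fps = fps_X ^ 2 * diag_binomial_fps 0"
proof (rule fps_ext)
  fix n :: nat
  have "{x \<in> {2..}. x = n} = (if n < 2 then {} else {n})"
    by auto
  then show "big_part_fps $ n = (fps_X ^ 2 * diag_binomial_fps 0) $ n"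
    by (simp add: big_part_fps_def weight_gf_nth fps_X_power_mult_nth diag_binomial_fps_def)
qed

lemma big_part_fps_mult: "big_part_fps * (1 - fps_X) = fps_X ^ 2"
  using diag_binomial_fps_mult[of 0] by (simp add: big_part_fps_eq mult.assoc)

lemma diag_binomial_fps_power: "diag_binomial_fps 0 ^ Suc r = diag_binomial_fps r"
proof -
  have "diag_binomial_fps 0 ^ Suc r * (1 - fps_X) ^ Suc r = diag_binomial_fps r * (1 - fps_X) ^ Suc r"
    using diag_binomial_fps_mult[of 0] diag_binomial_fps_mult[of r]
    by (metis power_mult_distrib power_one power_one_right One_nat_def)
  moreover have "(1 - fps_X :: int fps) ^ Suc r \<noteq> 0"
    by (metis diag_binomial_fps_mult mult_zero_right zero_neq_one)
  ultimately show ?thesis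
    using mult_right_cancel by blast
qed

text \<open>
  The coefficient of \<open>X\<^sup>j\<close> in \<open>1 / (1 - X)\<^sup>r\<close> is the second binomial of the claimed
  sum; the value 1 of the binomial of \<open>-1\<close> over 0 is what makes this right at \<open>r = 0\<close>.
\<close>

lemma big_part_fps_power_nth:
  "big_part_fps ^ r $ n =
     (if n < 2 * r then 0 else int (int_binom (int r + int (n - 2 * r) - 1) (int (n - 2 * r))))"
proof -
  have "big_part_fps ^ r = fps_X ^ (2 * r) * diag_binomial_fps 0 ^ r"
    by (simp add: big_part_fps_eq power_mult_distrib power_mult)
  moreover have "diag_binomial_fps 0 ^ r $ j = int (int_binom (int r + int j - 1) (int j))" for j
  proof (cases r)
    case 0
    then show ?thesis
      by (simp add: int_binom_def)
  next
    case (Suc s)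
    have "nat (int s + int j) = j + s"
      by simp
    then show ?thesis
      unfolding Suc diag_binomial_fps_power
      by (auto simp: int_binom_def diag_binomial_fps_def)
  qed
  ultimately show ?thesis
    by (simp add: fps_X_power_mult_nth)
qed

text \<open>
  Substituting \<open>Q\<close> for \<open>X\<close> in \<open>diag_binomial_fps_mult\<close>: the composite is
  \<open>1 / (1 - Q)\<^sup>k\<^sup>+\<^sup>1\<close>.
\<close>

lemma diag_binomial_compose_mult:
  "(diag_binomial_fps k oo big_part_fps) * (1 - big_part_fps) ^ Suc k = 1"
proof -
  have zero: "big_part_fps $ 0 = 0"
    by (simp add: big_part_fps_eq)
  have "(diag_binomial_fps k * (1 - fps_X) ^ Suc k) oo big_part_fps = 1"
    by (simp only: diag_binomial_fps_mult fps_compose_1)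
  moreover have "(1 - fps_X) oo big_part_fps = 1 - big_part_fps"
    using zero by (simp add: fps_compose_sub_distrib)
  ultimately show ?thesis
    using zero by (metis fps_compose_mult_distrib fps_compose_power)
qed

text \<open>
  The \<open>r\<close>th power of \<open>Q\<close> starts at exponent \<open>2 * r\<close>, so that \<open>r\<close> determines
  \<open>j = n - 2 * r\<close> and only \<open>2 * r \<le> n\<close> contributes.
\<close>

lemma diag_binomial_compose_nth:
  "(diag_binomial_fps k oo big_part_fps) $ n =
     int (\<Sum>(r, j) \<in> {(r, j). 2 * r + j = n}.
            int_binom (int r + int k) (int r) * int_binom (int r + int j - 1) (int j))"
    (is "_ = int (\<Sum>(r, j) \<in> ?S. ?f r j)")
proof -
  have binom: "int_binom (int r + int k) (int r) = (r + k choose r)" for r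
    by (simp add: int_binom_def flip: of_nat_add)
  have S: "?S = (\<lambda>r. (r, n - 2 * r)) ` {r \<in> {0..n}. 2 * r \<le> n}"
    by (auto simp: image_iff)
  have "(diag_binomial_fps k oo big_part_fps) $ n
      = (\<Sum>r = 0..n. if 2 * r \<le> n then int (?f r (n - 2 * r)) else 0)"
    unfolding fps_compose_nth
    by (intro sum.cong refl) (auto simp: binom big_part_fps_power_nth diag_binomial_fps_def)
  also have "\<dots> = (\<Sum>r \<in> {r \<in> {0..n}. 2 * r \<le> n}. int (?f r (n - 2 * r)))"
    by (rule sum.inter_filter[symmetric]) simp
  also have "\<dots> = int (\<Sum>(r, j) \<in> ?S. ?f r j)"
    unfolding S by (subst sum.reindex) (auto simp: inj_on_def)
  finally show ?thesis .
qed

lemma weight_gf_compositions_ones: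
  "weight_gf (word_weight (\<lambda>x. x)) (marked_words {1..} ((=) 1) k)
     = fps_X ^ k * (diag_binomial_fps k oo big_part_fps)" (is "?C = _")
proof -
  have "?C * (1 - weight_gf (\<lambda>x. x) {x \<in> {1..}. 1 \<noteq> x}) ^ Suc k
      = weight_gf (\<lambda>x. x) {x \<in> {1..}. 1 = x} ^ k"
    by (rule weight_gf_marked_words) (auto intro: finite_fibres_inj)
  moreover have "{x \<in> {1..}. 1 \<noteq> x} = {2 :: nat..}" "{x \<in> {1..}. 1 = x} = {1 :: nat}"
    by auto
  ultimately have C: "?C * (1 - big_part_fps) ^ Suc k = fps_X ^ k"
    by (simp add: weight_gf_singleton flip: big_part_fps_def)
  have "?C = ?C * ((diag_binomial_fps k oo big_part_fps) * (1 - big_part_fps) ^ Suc k)"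
    by (simp only: diag_binomial_compose_mult mult_1_right)
  also have "\<dots> = (?C * (1 - big_part_fps) ^ Suc k) * (diag_binomial_fps k oo big_part_fps)"
    by (simp only: ac_simps)
  finally show ?thesis
    by (simp only: C)
qed

section \<open>Pairs of mirrored parts\<close>

text \<open>
  The pairs of mirrored parts from the outside inwards, each with its smaller entry first, so that
  a swap does not change them.
\<close>

definition mirror_pairs :: "nat list \<Rightarrow> (nat \<times> nat) list" where
  "mirror_pairs \<alpha> = map (\<lambda>(a, b). (min a b, max a b))
     (zip (take (length \<alpha> div 2) \<alpha>) (take (length \<alpha> div 2) (rev \<alpha>)))"

text \<open>
  In a composition all parts are positive, which leaves the value 0 free to encode the absence of
  a middle part.
\<close>

definition middle_part :: "nat list \<Rightarrow> nat" where
  "middle_part \<alpha> = (if odd (length \<alpha>) then \<alpha> ! (length \<alpha> div 2) else 0)"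

lemma length_mirror_pairs [simp]: "length (mirror_pairs \<alpha>) = length \<alpha> div 2"
  by (simp add: mirror_pairs_def)

lemma mirror_pairs_nth:
  "i < length \<alpha> div 2 \<Longrightarrow> mirror_pairs \<alpha> ! i =
     (min (\<alpha> ! i) (\<alpha> ! (length \<alpha> - 1 - i)), max (\<alpha> ! i) (\<alpha> ! (length \<alpha> - 1 - i)))"
  by (simp add: mirror_pairs_def rev_nth)

lemma palindromic_pairs_eq:
  "palindromic_pairs \<alpha> = length (filter (\<lambda>(a, b). a = b) (mirror_pairs \<alpha>))"
  unfolding palindromic_pairs_def length_filter_conv_card
  by (rule arg_cong[of _ _ card]) (auto simp: mirror_pairs_nth)

lemma list_halves:
  "\<alpha> = take (length \<alpha> div 2) \<alpha> @ (if odd (length \<alpha>) then [\<alpha> ! (length \<alpha> div 2)] else [])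
         @ rev (take (length \<alpha> div 2) (rev \<alpha>))"
proof -
  let ?h = "length \<alpha> div 2"
  have right: "rev (take ?h (rev \<alpha>)) = drop (length \<alpha> - ?h) \<alpha>"
    by (simp add: take_rev)
  have "drop ?h \<alpha> = (if odd (length \<alpha>) then [\<alpha> ! ?h] else []) @ drop (length \<alpha> - ?h) \<alpha>"
  proof (cases "odd (length \<alpha>)")
    case True
    then have "length \<alpha> - ?h = Suc ?h" "?h < length \<alpha>"
      by (auto elim!: oddE)
    then show ?thesis
      using True by (simp add: Cons_nth_drop_Suc)
  next
    case False
    then have "length \<alpha> - ?h = ?h"
      by (auto elim!: evenE)
    then show ?thesis
      using False by simp
  qed
  then show ?thesis
    unfolding right by (metis append_take_drop_id)
qed

lemma sum_list_mirror_pairs: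
  "sum_list \<alpha> = word_weight (\<lambda>(a, b). a + b) (mirror_pairs \<alpha>) + middle_part \<alpha>"
proof -
  let ?h = "length \<alpha> div 2"
  have zip: "word_weight (\<lambda>(a, b). a + b) (map (\<lambda>(a, b). (min a b, max a b)) (zip xs ys))
      = sum_list xs + sum_list ys" if "length xs = length ys" for xs ys :: "nat list"
    using that by (induction xs ys rule: list_induct2) (auto simp: min_def max_def)
  have "sum_list \<alpha> = sum_list (take ?h \<alpha>) + middle_part \<alpha> + sum_list (take ?h (rev \<alpha>))"
    by (subst list_halves) (auto simp: middle_part_def sum_list_rev simp del: rev_take)
  then show ?thesis
    unfolding mirror_pairs_def by (subst zip) auto
qed

lemma parts_positive_mirror_pairs:
  "\<alpha> \<in> lists {1..} \<longleftrightarrow> mirror_pairs \<alpha> \<in> lists ({1..} \<times> {1..}) \<and> (even (length \<alpha>) \<or> 1 \<le> middle_part \<alpha>)"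
proof -
  let ?h = "length \<alpha> div 2"
  have zip: "map (\<lambda>(a, b). (min a b, max a b)) (zip xs ys) \<in> lists ({1..} \<times> {1..})
      \<longleftrightarrow> xs \<in> lists {1..} \<and> ys \<in> lists {1..}" if "length xs = length ys" for xs ys :: "nat list"
    using that by (induction xs ys rule: list_induct2) (auto simp: min_def max_def)
  have "\<alpha> \<in> lists {1..} \<longleftrightarrow> take ?h \<alpha> \<in> lists {1..} \<and> (even (length \<alpha>) \<or> 1 \<le> middle_part \<alpha>)
      \<and> take ?h (rev \<alpha>) \<in> lists {1..}"
    by (subst (1) list_halves) (auto simp: middle_part_def simp del: rev_take)
  then show ?thesis
    unfolding mirror_pairs_def by (subst zip) auto
qed

lemma mirror_swap_invariant:
  assumes "i < length \<alpha> div 2"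
  shows "length (mirror_swap i \<alpha>) = length \<alpha>"
    and "mirror_pairs (mirror_swap i \<alpha>) = mirror_pairs \<alpha>"
    and "middle_part (mirror_swap i \<alpha>) = middle_part \<alpha>"
proof -
  show len: "length (mirror_swap i \<alpha>) = length \<alpha>"
    by (simp add: mirror_swap_def)
  show "mirror_pairs (mirror_swap i \<alpha>) = mirror_pairs \<alpha>"
    using assms
    by (intro nth_equalityI)
      (auto simp: len mirror_pairs_nth mirror_swap_def nth_list_update min.commute max.commute)
  show "middle_part (mirror_swap i \<alpha>) = middle_part \<alpha>"
    using assms by (auto simp: middle_part_def len mirror_swap_def nth_list_update elim!: oddE)
qed

text \<open>
  The pairs are corrected one after the other from the outside inwards: at each one, either nothing
  or a single swap is needed.
\<close>

lemma swap_equiv_of_mirror_pairs: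
  assumes len: "length \<alpha> = length \<beta>"
    and pairs: "mirror_pairs \<alpha> = mirror_pairs \<beta>" and middle: "middle_part \<alpha> = middle_part \<beta>"
  shows "(\<alpha>, \<beta>) \<in> swap_equiv"
proof -
  define l where "l = length \<beta>"
  \<comment> \<open>\<open>\<gamma> m\<close> agrees with \<open>\<beta>\<close> on the \<open>m\<close> outermost pairs and with \<open>\<alpha>\<close> elsewhere.\<close>
  define \<gamma> where "\<gamma> m = map (\<lambda>i. if i < m \<or> l - m \<le> i then \<beta> ! i else \<alpha> ! i) [0..<l]" for m
  have nth: "\<gamma> m ! i = (if i < m \<or> l - m \<le> i then \<beta> ! i else \<alpha> ! i)" if "i < l" for m i
    using that by (simp add: \<gamma>_def)
  have len\<gamma>: "length (\<gamma> m) = l" for m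
    by (simp add: \<gamma>_def)
  have "(\<alpha>, \<gamma> m) \<in> swap_equiv" if "m \<le> l div 2" for m
    using that
  proof (induction m)
    case 0
    have "\<gamma> 0 = \<alpha>"
      by (rule nth_equalityI) (simp_all add: nth len\<gamma> l_def len)
    then show ?case
      by (simp add: swap_equiv_def)
  next
    case (Suc m)
    then have m: "m < l div 2"
      by simp
    have "mirror_pairs \<alpha> ! m = mirror_pairs \<beta> ! m"
      by (simp add: pairs)
    then have "(\<alpha> ! m = \<beta> ! m \<and> \<alpha> ! (l - 1 - m) = \<beta> ! (l - 1 - m))
        \<or> (\<alpha> ! m = \<beta> ! (l - 1 - m) \<and> \<alpha> ! (l - 1 - m) = \<beta> ! m)"
      using m len by (auto simp: mirror_pairs_nth l_def min_def max_def split: if_splits)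
    then have "\<gamma> (Suc m) = \<gamma> m \<or> \<gamma> (Suc m) = mirror_swap m (\<gamma> m)"
    proof
      assume eq: "\<alpha> ! m = \<beta> ! m \<and> \<alpha> ! (l - 1 - m) = \<beta> ! (l - 1 - m)"
      have "\<gamma> (Suc m) ! i = \<gamma> m ! i" if "i < l" for i
        using that m eq by (cases "i = m"; cases "i = l - 1 - m") (auto simp: nth)
      then show ?thesis
        by (auto intro: nth_equalityI simp: len\<gamma>)
    next
      assume eq: "\<alpha> ! m = \<beta> ! (l - 1 - m) \<and> \<alpha> ! (l - 1 - m) = \<beta> ! m"
      have "\<gamma> (Suc m) ! i = mirror_swap m (\<gamma> m) ! i" if "i < l" for i
        using that m eq
        by (cases "i = m"; cases "i = l - 1 - m") (auto simp: nth mirror_swap_def len\<gamma> nth_list_update)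
      then show ?thesis
        by (auto intro: nth_equalityI simp: len\<gamma> mirror_swap_def)
    qed
    moreover have "(\<gamma> m, mirror_swap m (\<gamma> m)) \<in> swap_step"
      using m by (auto simp: swap_step_def len\<gamma>)
    ultimately show ?case
      using Suc by (auto simp: swap_equiv_def intro: rtrancl_into_rtrancl)
  qed
  moreover have "\<gamma> (l div 2) = \<beta>"
  proof (rule nth_equalityI)
    fix i assume "i < length (\<gamma> (l div 2))"
    then have i: "i < l"
      by (simp add: len\<gamma>)
    show "\<gamma> (l div 2) ! i = \<beta> ! i"
    proof (cases "i < l div 2 \<or> l - l div 2 \<le> i")
      case False
      \<comment> \<open>Only the middle position of a list of odd length belongs to no pair.\<close>
      then have "i = l div 2" "odd l"
        using i by presburger+
      then show ?thesis
        using middle i len by (simp add: nth middle_part_def l_def)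
    qed (simp add: nth i)
  qed (simp add: len\<gamma> l_def)
  ultimately show ?thesis
    by (metis order_refl)
qed

lemma swap_equiv_iff:
  "(\<alpha>, \<beta>) \<in> swap_equiv \<longleftrightarrow>
     length \<alpha> = length \<beta> \<and> mirror_pairs \<alpha> = mirror_pairs \<beta> \<and> middle_part \<alpha> = middle_part \<beta>"
proof
  assume "(\<alpha>, \<beta>) \<in> swap_equiv"
  then show "length \<alpha> = length \<beta> \<and> mirror_pairs \<alpha> = mirror_pairs \<beta> \<and> middle_part \<alpha> = middle_part \<beta>"
    unfolding swap_equiv_def
    by (induction rule: rtrancl_induct) (auto simp: swap_step_def mirror_swap_invariant)
qed (blast intro: swap_equiv_of_mirror_pairs)

lemma card_quotient_eq_card_image:
  assumes "equiv UNIV R" and "\<And>x y. x \<in> A \<Longrightarrow> y \<in> A \<Longrightarrow> (x, y) \<in> R \<longleftrightarrow> f x = f y"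
  shows "card (A // R) = card (f ` A)"
proof -
  have eq: "R `` {x} = R `` {y} \<longleftrightarrow> f x = f y" if "x \<in> A" "y \<in> A" for x y
    using that assms(2) eq_equiv_class_iff[OF assms(1)] by simp
  define g where "g y = R `` {x \<in> A. f x = y}" for y
  have g: "g (f x) = R `` {x}" if "x \<in> A" for x
    using that eq by (fastforce simp: g_def)
  then have "A // R = g ` f ` A"
    by (auto simp: quotient_def image_iff)
  moreover have "inj_on g (f ` A)"
    using g eq by (auto simp: inj_on_def)
  ultimately show ?thesis
    by (simp add: card_image)
qed

section \<open>The generating function of the classes\<close>

lemma weight_gf_equal_pairs:
  "weight_gf (\<lambda>(a, b). a + b) {(a, b). 1 \<le> a \<and> a = b} * (1 - fps_X ^ 2) = fps_X ^ 2"
proof -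
  have "weight_gf (\<lambda>(a, b). a + b) {(a, b). 1 \<le> a \<and> a = b} = weight_gf (\<lambda>i. 2 + 2 * i) UNIV"
    by (rule weight_gf_cong_bij[where f = "\<lambda>i. (Suc i, Suc i)"])
      (auto simp: bij_betw_def inj_on_def image_iff Suc_le_eq gr0_conv_Suc)
  then show ?thesis
    using weight_gf_multiples[of 2] by (simp only: weight_gf_shift mult.assoc) simp
qed

text \<open>
  A pair \<open>a < b\<close> is determined by \<open>i = a - 1\<close> and \<open>j = b - a - 1\<close>, and then
  \<open>a + b = 3 + 2 * i + j\<close> with \<open>i\<close> and \<open>j\<close> arbitrary.
\<close>

lemma weight_gf_distinct_pairs:
  "weight_gf (\<lambda>(a, b). a + b) {(a, b). 1 \<le> a \<and> a < b} * (1 - fps_X) * (1 - fps_X ^ 2) = fps_X ^ 3"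
proof -
  let ?w = "\<lambda>(i, j). 2 * i + 1 * j :: nat"
  have fin: "finite_fibres (\<lambda>i. d * i) UNIV" if "d > 0" for d :: nat
    using that by (intro finite_fibres_inj) (auto simp: inj_on_def)
  have times: "weight_gf ?w (UNIV \<times> UNIV) = weight_gf (\<lambda>i. 2 * i) UNIV * weight_gf (\<lambda>i. 1 * i) UNIV"
    by (intro weight_gf_Times fin) auto
  have "weight_gf (\<lambda>(a, b). a + b) {(a, b). 1 \<le> a \<and> a < b} = weight_gf (\<lambda>p. 3 + ?w p) (UNIV \<times> UNIV)"
  proof (rule weight_gf_cong_bij[where f = "\<lambda>(i, j). (Suc i, Suc (Suc (i + j)))"])
    have "\<exists>i j. (a, b) = (Suc i, Suc (Suc (i + j)))" if "1 \<le> a" "a < b" for a b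
      using that by (intro exI[of _ "a - 1"] exI[of _ "b - a - 1"]) auto
    then show "bij_betw (\<lambda>(i, j). (Suc i, Suc (Suc (i + j)))) (UNIV \<times> UNIV) {(a, b). 1 \<le> a \<and> a < b}"
      by (fastforce simp: bij_betw_def inj_on_def image_iff)
  qed auto
  also have "\<dots> = fps_X ^ 3 * (weight_gf (\<lambda>i. 2 * i) UNIV * weight_gf (\<lambda>i. 1 * i) UNIV)"
    by (simp only: weight_gf_shift times)
  finally have "weight_gf (\<lambda>(a, b). a + b) {(a, b). 1 \<le> a \<and> a < b} * (1 - fps_X) * (1 - fps_X ^ 2)
      = fps_X ^ 3 * (weight_gf (\<lambda>i. 2 * i) UNIV * (1 - fps_X ^ 2))
          * (weight_gf (\<lambda>i. 1 * i) UNIV * (1 - fps_X ^ 1))"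
    by (simp add: ac_simps)
  then show ?thesis
    by (simp only: weight_gf_multiples zero_less_numeral zero_less_one mult_1_right)
qed

lemma weight_gf_even: "weight_gf (\<lambda>x. x) {x. even x} * (1 - fps_X ^ 2) = 1"
proof -
  have "weight_gf (\<lambda>x. x) {x. even x} = weight_gf (\<lambda>i. 2 * i) UNIV"
    by (rule weight_gf_cong_bij[where f = "\<lambda>i. 2 * i"]) (auto simp: bij_betw_def inj_on_def)
  then show ?thesis
    using weight_gf_multiples[of 2] by simp
qed

abbreviation sorted_pairs :: "(nat \<times> nat) set" where
  "sorted_pairs \<equiv> {(a, b). 1 \<le> a \<and> a \<le> b}"

text \<open>
  Swap classes of compositions with \<open>k\<close> palindromic pairs, for even or absent middle part, encoded
  as a word of pairs and a middle part.
\<close>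

definition class_codes :: "nat \<Rightarrow> ((nat \<times> nat) list \<times> nat) set" where
  "class_codes k = marked_words sorted_pairs (\<lambda>(a, b). a = b) k \<times> {m. even m}"

definition code_weight :: "(nat \<times> nat) list \<times> nat \<Rightarrow> nat" where
  "code_weight = (\<lambda>(ps, m). word_weight (\<lambda>(a, b). a + b) ps + m)"

lemma finite_fibres_sorted_pairs: "finite_fibres (\<lambda>(a, b). a + b) sorted_pairs"
  unfolding finite_fibres_def
proof
  fix n :: nat
  have "{p \<in> sorted_pairs. (case p of (a, b) \<Rightarrow> a + b) = n} \<subseteq> {..n} \<times> {..n}"
    by auto
  then show "finite {p \<in> sorted_pairs. (case p of (a, b) \<Rightarrow> a + b) = n}"
    by (rule finite_subset) simp
qed

text \<open>
  With the series \<open>L\<close> of the words of pairs and \<open>E\<close> of the middle parts, the product \<open>L * E\<close> is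
  multiplied by \<open>v * D\<^sup>k\<^sup>+\<^sup>1\<close>, where \<open>v = 1 - X\<^sup>2\<close> and \<open>D = 1 - X - X\<^sup>2\<close>. This
  clears all denominators, because \<open>D\<close> is a multiple of both \<open>1 - N\<close> (for \<open>N\<close> the series of the
  pairs with distinct entries) and \<open>1 - Q\<close>.
\<close>

lemma weight_gf_class_codes:
  "weight_gf code_weight (class_codes k) = fps_X ^ (2 * k) * (diag_binomial_fps k oo big_part_fps)"
proof -
  define L where "L = weight_gf (word_weight (\<lambda>(a, b). a + b)) (marked_words sorted_pairs (\<lambda>(a, b). a = b) k)"
  define N where "N = weight_gf (\<lambda>(a, b). a + b) {(a, b). 1 \<le> a \<and> a < (b :: nat)}"
  define P where "P = weight_gf (\<lambda>(a, b). a + b) {(a, b). 1 \<le> a \<and> a = (b :: nat)}"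
  define E where "E = weight_gf (\<lambda>x. x) {x. even (x :: nat)}"
  define J where "J = (diag_binomial_fps k oo big_part_fps)"
  define u :: "int fps" where "u = 1 - fps_X"
  define v :: "int fps" where "v = 1 - fps_X ^ 2"
  define D :: "int fps" where "D = 1 - fps_X - fps_X ^ 2"
  have split: "{p \<in> sorted_pairs. \<not> (case p of (a, b) \<Rightarrow> a = b)} = {(a, b). 1 \<le> a \<and> a < b}"
    "{p \<in> sorted_pairs. case p of (a, b) \<Rightarrow> a = b} = {(a, b). 1 \<le> a \<and> a = b}"
    by auto
  have L: "L * (1 - N) ^ Suc k = P ^ k"
    using weight_gf_marked_words[OF finite_fibres_sorted_pairs, of "\<lambda>(a, b). a = b" k]
    unfolding split by (auto simp: L_def N_def P_def)
  have P: "P * v = fps_X ^ 2" and N: "N * u * v = fps_X ^ 3" and E: "E * v = 1"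
    using weight_gf_equal_pairs weight_gf_distinct_pairs weight_gf_even
    by (simp_all add: P_def N_def E_def u_def v_def)
  have "finite_fibres (word_weight (\<lambda>(a, b). a + b)) (marked_words sorted_pairs (\<lambda>(a, b). a = b) k)"
    by (rule finite_fibres_subset[OF finite_fibres_lists[OF finite_fibres_sorted_pairs]])
      (auto simp: marked_words_def)
  moreover have "finite_fibres (\<lambda>x. x) {x. even (x :: nat)}"
    by (intro finite_fibres_inj) auto
  ultimately have A: "weight_gf code_weight (class_codes k) = L * E"
    unfolding code_weight_def class_codes_def L_def E_def by (rule weight_gf_Times)
  have ND: "(1 - N) * u * v = D"
  proof -
    have "(1 - N) * u * v = u * v - N * u * v"
      by (simp add: algebra_simps)
    then show ?thesis
      unfolding N by (simp add: u_def v_def D_def algebra_simps power2_eq_square power3_eq_cube)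
  qed
  have QD: "(1 - big_part_fps) * u = D"
    using big_part_fps_mult by (simp add: u_def D_def algebra_simps)
  have J: "J * (1 - big_part_fps) ^ Suc k = 1"
    using diag_binomial_compose_mult by (simp add: J_def)
  have "L * E * (v * D ^ Suc k) = (E * v) * (L * (1 - N) ^ Suc k) * u ^ Suc k * v ^ Suc k"
    unfolding ND[symmetric] by (simp only: power_mult_distrib ac_simps)
  also have "\<dots> = (P * v) ^ k * u ^ Suc k * v"
    unfolding E L by (simp add: power_mult_distrib ac_simps)
  also have "\<dots> = fps_X ^ (2 * k) * u ^ Suc k * v"
    unfolding P by (simp only: power_mult)
  also have "\<dots> = fps_X ^ (2 * k) * (J * (1 - big_part_fps) ^ Suc k) * u ^ Suc k * v"
    unfolding J by simp
  also have "\<dots> = fps_X ^ (2 * k) * J * (v * D ^ Suc k)"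
    unfolding QD[symmetric] by (simp only: power_mult_distrib ac_simps)
  finally have "L * E * (v * D ^ Suc k) = fps_X ^ (2 * k) * J * (v * D ^ Suc k)" .
  moreover have "v * D ^ Suc k \<noteq> 0"
  proof -
    have "(v * D ^ Suc k) $ 0 \<noteq> 0"
      by (simp add: v_def D_def fps_nth_power_0)
    then show ?thesis
      by auto
  qed
  ultimately show ?thesis
    unfolding A J_def using mult_right_cancel by blast
qed

text \<open>
  The map to pairs and middle part separates the classes: for positive parts the code determines
  the length, as its middle part is 0 exactly when the length is even. Conversely a code is realised
  by the composition that reads the smaller entries forwards, then the middle part if it is nonzero,
  then the larger entries backwards.
\<close>

lemma rac_plus_eq_card_codes:
  "rac_plus k n = card {c \<in> class_codes k. code_weight c = n}"
proof -
  let ?A = "{\<alpha> \<in> compositions (int n). palindromic_pairs \<alpha> = k \<and>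
              (even (length \<alpha>) \<or> odd (length \<alpha>) \<and> even (\<alpha> ! (length \<alpha> div 2)))}"
  let ?f = "\<lambda>\<alpha>. (mirror_pairs \<alpha>, middle_part \<alpha>)"
  have A: "?A = {\<alpha> \<in> lists {1..}. sum_list \<alpha> = n \<and> palindromic_pairs \<alpha> = k \<and> even (middle_part \<alpha>)}"
    by (auto simp: compositions_int middle_part_def)
  have odd_iff: "odd (length \<alpha>) \<longleftrightarrow> middle_part \<alpha> \<noteq> 0" if "\<alpha> \<in> lists {1..}" for \<alpha>
    using that parts_positive_mirror_pairs[of \<alpha>] by (auto simp: middle_part_def)
  have "(\<alpha>, \<beta>) \<in> swap_equiv \<longleftrightarrow> ?f \<alpha> = ?f \<beta>" if "\<alpha> \<in> ?A" "\<beta> \<in> ?A" for \<alpha> \<beta>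
  proof -
    have "length \<alpha> = length \<beta>" if eq: "?f \<alpha> = ?f \<beta>"
    proof -
      have "length \<alpha> div 2 = length \<beta> div 2"
        using arg_cong[OF eq, of "length \<circ> fst"] by simp
      moreover have "odd (length \<alpha>) = odd (length \<beta>)"
        using eq odd_iff \<open>\<alpha> \<in> ?A\<close> \<open>\<beta> \<in> ?A\<close> unfolding A by auto
      ultimately show ?thesis
        by presburger
    qed
    then show ?thesis
      by (auto simp: swap_equiv_iff)
  qed
  then have "rac_plus k n = card (?f ` ?A)"
    unfolding rac_plus_def by (rule card_quotient_eq_card_image[OF equiv_swap_equiv])
  also have "?f ` ?A = {c \<in> class_codes k. code_weight c = n}"
  proof (intro equalityI subsetI)
    fix c assume "c \<in> ?f ` ?A"
    then obtain \<alpha> where \<alpha>: "\<alpha> \<in> ?A" and c: "c = ?f \<alpha>"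
      by blast
    have pos: "set (mirror_pairs \<alpha>) \<subseteq> {1..} \<times> {1..}"
      using \<alpha> parts_positive_mirror_pairs[of \<alpha>] unfolding A in_lists_conv_set by blast
    have le: "a \<le> b" if "(a, b) \<in> set (mirror_pairs \<alpha>)" for a b
      using that by (auto simp: mirror_pairs_def)
    have "p \<in> sorted_pairs" if "p \<in> set (mirror_pairs \<alpha>)" for p
      using subsetD[OF pos that] le[of "fst p" "snd p"] that by (cases p) simp
    then have "mirror_pairs \<alpha> \<in> lists sorted_pairs"
      by blast
    then show "c \<in> {c \<in> class_codes k. code_weight c = n}"
      using \<alpha> unfolding A c
      by (auto simp: class_codes_def code_weight_def marked_words_def palindromic_pairs_eq
          sum_list_mirror_pairs[of \<alpha>])
  next
    fix c assume c: "c \<in> {c \<in> class_codes k. code_weight c = n}"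
    obtain ps m where psm: "c = (ps, m)"
      by (cases c)
    have ps: "ps \<in> lists sorted_pairs" "length (filter (\<lambda>(a, b). a = b) ps) = k" "even m"
      and weight: "word_weight (\<lambda>(a, b). a + b) ps + m = n"
      using c by (auto simp: psm class_codes_def code_weight_def marked_words_def)
    define mid where "mid = (if m = 0 then [] else [m])"
    define \<alpha> where "\<alpha> = map fst ps @ mid @ rev (map snd ps)"
    have len: "length \<alpha> div 2 = length ps"
      by (simp add: \<alpha>_def mid_def)
    have "map (\<lambda>(a, b). (min a b, max a b)) ps = ps"
      using ps(1) by (intro map_idI) (auto simp: min_def max_def)
    then have pairs: "mirror_pairs \<alpha> = ps"
      unfolding mirror_pairs_def len by (simp add: \<alpha>_def rev_map zip_map_fst_snd)
    have middle: "middle_part \<alpha> = m"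
      unfolding middle_part_def len by (simp add: \<alpha>_def mid_def nth_append)
    have pos: "1 \<le> a \<and> 1 \<le> b" if "(a, b) \<in> set ps" for a b
    proof -
      have "(a, b) \<in> sorted_pairs"
        using ps(1) that by blast
      then show ?thesis
        by simp
    qed
    have "\<alpha> \<in> lists {1..}"
      using pos by (auto simp: \<alpha>_def mid_def)
    then have "\<alpha> \<in> ?A"
      unfolding A using ps weight by (simp add: palindromic_pairs_eq sum_list_mirror_pairs[of \<alpha>] pairs middle)
    moreover have "c = ?f \<alpha>"
      by (simp add: psm pairs middle)
    ultimately show "c \<in> ?f ` ?A"
      by (rule rev_image_eqI)
  qed
  finally show ?thesis .
qed

theorem theorem3p2:
  fixes n k :: nat
  shows "rac_plus k n =
           (\<Sum>(r, j) \<in> {(r, j). 2 * int r + int j = int n - 2 * int k}.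
              int_binom (int r + int k) (int r) * int_binom (int r + int j - 1) (int j))
         \<and> rac_plus k n =
           card {\<alpha> \<in> compositions (int n - int k). count_list \<alpha> 1 = k}"
proof
  let ?J = "diag_binomial_fps k oo big_part_fps"
  have rac: "int (rac_plus k n) = (if n < 2 * k then 0 else ?J $ (n - 2 * k))"
    using weight_gf_class_codes[of k]
    by (simp add: rac_plus_eq_card_codes fps_X_power_mult_nth flip: weight_gf_nth)
  show "rac_plus k n =
           (\<Sum>(r, j) \<in> {(r, j). 2 * int r + int j = int n - 2 * int k}.
              int_binom (int r + int k) (int r) * int_binom (int r + int j - 1) (int j))"
  proof (cases "n < 2 * k")
    case True
    then have "{(r, j). 2 * int r + int j = int n - 2 * int k} = {}"
      by auto
    then show ?thesis
      using rac True by simp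
  next
    case False
    then have index: "{(r, j). 2 * int r + int j = int n - 2 * int k} = {(r, j). 2 * r + j = n - 2 * k}"
      by auto
    then show ?thesis
      using rac False unfolding index diag_binomial_compose_nth by (simp only: if_False of_nat_eq_iff)
  qed
  show "rac_plus k n = card {\<alpha> \<in> compositions (int n - int k). count_list \<alpha> 1 = k}"
  proof (cases "n < k")
    case True
    then show ?thesis
      using rac by (simp add: compositions_negative)
  next
    case False
    have "{\<alpha> \<in> compositions (int (n - k)). count_list \<alpha> 1 = k}
        = {\<alpha> \<in> marked_words {1..} ((=) 1) k. word_weight (\<lambda>x. x) \<alpha> = n - k}"
      by (auto simp: compositions_int marked_words_def count_list_eq_length_filter)
    then have "int (card {\<alpha> \<in> compositions (int (n - k)). count_list \<alpha> 1 = k})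
        = weight_gf (word_weight (\<lambda>x. x)) (marked_words {1..} ((=) 1) k) $ (n - k)"
      by (simp add: weight_gf_nth)
    also have "\<dots> = int (rac_plus k n)"
      using False rac unfolding weight_gf_compositions_ones
      by (auto simp: fps_X_power_mult_nth intro: arg_cong[of _ _ "fps_nth ?J"])
    finally show ?thesis
      using False by (simp add: of_nat_diff)
  qed
qed

end
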